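(* Let $\mathbf V$ be a variety of loops and $\mathcal W$ a set of words that generates inner mapping groups in $\mathbf V$. If for $Q\in\mathbf V$ there is an integer $n>0$ such that $L_x^n=R_x^n=1$ (the identity mapping) for every $x\in Q$, then $$[\alpha,\beta] = \mathrm{Cg}\big(\{(W_{\bar u}(a), W_{\bar v}(a)) : W\in\mathcal W,\ 1\,\alpha\,a,\ \bar u\,\beta\,\bar v\}\big)$$ for any congruences $\alpha$, $\beta$ of $Q$.
   Context: A loop is an algebra $(Q,1,\cdot,\backslash,/)$ satisfying $x\cdot 1=x=1\cdot x$, $x\backslash(x\cdot y)=y$, $x\cdot(x\backslash y)=y$, $(y\cdot x)/x=y$, $(y/x)\cdot x=y$. For $x\in Q$ define bijections of $Q$ by $L_x(y)=xy$, $R_x(y)=yx$, $M_x(y)=y\backslash x$. Put $\mathrm{Mlt}(Q)=\langle L_x,R_x : x\in Q\rangle$, $\mathrm{TMlt}(Q)=\langle L_x,R_x,M_x : x\in Q\rangle$; the inner mapping group $\mathrm{Inn}(Q)$ and total inner mapping group $\mathrm{TInn}(Q)$ are the stabilizers of $1$ in $\mathrm{Mlt}(Q)$ and $\mathrm{TMlt}(Q)$, respectively. A word $W=W_{\bar x}$ in a finite tuple of variables $\bar x=x_1,\dots,x_n$ is an element of the free group on the letters $K_t$, where $K\in\{L,R,M\}$ and $t$ is a loop term over $\bar x$. For a loop $Q$ and a tuple $\bar a$ over $Q$, $W_{\bar a}\in\mathrm{TMlt}(Q)$ is the mapping obtained by replacing each letter $K_{t(\bar x)}^{\pm1}$ by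 the actual mapping $K_{t(\bar a)}^{\pm1}$ of $Q$. The word $W$ is inner for a variety $\mathbf V$ of loops if $W_{\bar a}\in\mathrm{TInn}(Q)$ for every $Q\in\mathbf V$ and every tuple $\bar a$ over $Q$. A set $\mathcal W$ of inner words for $\mathbf V$ generates inner mapping groups in $\mathbf V$ if $\mathrm{Inn}(Q)=\langle W_{\bar a} : W\in\mathcal W,\ \bar a\text{ a tuple over }Q\rangle$ for every $Q\in\mathbf V$. For congruences $\alpha,\beta,\delta$ of an algebra, $C(\alpha,\beta;\delta)$ means that for every $(n+1)$-ary term operation $t$, every $a\,\alpha\,b$ and every $u_1\,\beta\,v_1,\dots,u_n\,\beta\,v_n$, $t(a,u_1,\dots,u_n)\,\delta\,t(a,v_1,\dots,v_n)$ implies $t(b,u_1,\dots,u_n)\,\delta\,t(b,v_1,\dots,v_n)$. The commutator $[\alpha,\beta]$ is the smallest congruence $\delta$ with $C(\alpha,\beta;\delta)$. $\mathrm{Cg}(X)$ is the congruence generated by $X$. For tuples, $\bar u\,\beta\,\bar v$ means $u_i\,\beta\,v_i$ for all $i$. *)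

theory Defs
  imports "HOL-Algebra.Algebra"
begin

section \<open>Loops\<close>

text \<open>The record extends the library's \<open>monoid\<close> record, which supplies only the signature
  (carrier, multiplication, unit); associativity is not assumed.\<close>

record 'a loop = "'a monoid" +
  ldiv :: "'a \<Rightarrow> 'a \<Rightarrow> 'a"
  rdiv :: "'a \<Rightarrow> 'a \<Rightarrow> 'a"

locale loop =
  fixes Q :: "('a, 'b) loop_scheme" (structure)
  assumes one_closed: "\<one> \<in> carrier Q"
    and mult_closed: "\<lbrakk>x \<in> carrier Q; y \<in> carrier Q\<rbrakk> \<Longrightarrow> x \<otimes> y \<in> carrier Q"
    and ldiv_closed: "\<lbrakk>x \<in> carrier Q; y \<in> carrier Q\<rbrakk> \<Longrightarrow> ldiv Q x y \<in> carrier Q"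
    and rdiv_closed: "\<lbrakk>x \<in> carrier Q; y \<in> carrier Q\<rbrakk> \<Longrightarrow> rdiv Q x y \<in> carrier Q"
    and mult_one_right: "x \<in> carrier Q \<Longrightarrow> x \<otimes> \<one> = x"
    and mult_one_left: "x \<in> carrier Q \<Longrightarrow> \<one> \<otimes> x = x"
    and ldiv_mult: "\<lbrakk>x \<in> carrier Q; y \<in> carrier Q\<rbrakk> \<Longrightarrow> ldiv Q x (x \<otimes> y) = y"
    and mult_ldiv: "\<lbrakk>x \<in> carrier Q; y \<in> carrier Q\<rbrakk> \<Longrightarrow> x \<otimes> ldiv Q x y = y"
    and mult_rdiv: "\<lbrakk>x \<in> carrier Q; y \<in> carrier Q\<rbrakk> \<Longrightarrow> rdiv Q (y \<otimes> x) x = y"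
    and rdiv_mult: "\<lbrakk>x \<in> carrier Q; y \<in> carrier Q\<rbrakk> \<Longrightarrow> rdiv Q y x \<otimes> x = y"

section \<open>Terms and varieties\<close>

text \<open>Variables are indexed by natural numbers, and a tuple of values for the variables is an
  assignment \<open>nat \<Rightarrow> 'a\<close> with values in the carrier. A term, and likewise a word below, involves
  only finitely many variables, so only a finite part of the assignment matters.\<close>

datatype loop_term =
    Var nat
  | One
  | Mult loop_term loop_term
  | LDiv loop_term loop_term
  | RDiv loop_term loop_term

primrec eval_term :: "('a, 'b) loop_scheme \<Rightarrow> (nat \<Rightarrow> 'a) \<Rightarrow> loop_term \<Rightarrow> 'a" where
  "eval_term Q a (Var i) = a i"
| "eval_term Q a One = \<one>\<^bsub>Q\<^esub>"
| "eval_term Q a (Mult s t) = eval_term Q a s \<otimes>\<^bsub>Q\<^esub> eval_term Q a t"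
| "eval_term Q a (LDiv s t) = ldiv Q (eval_term Q a s) (eval_term Q a t)"
| "eval_term Q a (RDiv s t) = rdiv Q (eval_term Q a s) (eval_term Q a t)"

definition tuple_over :: "('a, 'b) loop_scheme \<Rightarrow> (nat \<Rightarrow> 'a) \<Rightarrow> bool" where
  "tuple_over Q a \<longleftrightarrow> (\<forall>i. a i \<in> carrier Q)"

text \<open>A variety is an equational class. The type \<open>'a\<close> plays the role of the universe from
  which carriers are taken. It should be infinite, so that the free loops on finitely or
  countably many generators of the equational class live on subsets of \<open>'a\<close>.\<close>

definition loop_variety :: "'a loop set \<Rightarrow> bool" where
  "loop_variety V \<longleftrightarrow> (\<exists>E :: (loop_term \<times> loop_term) set.
     V = {Q. loop Q \<and> (\<forall>(s, t) \<in> E. \<forall>a. tuple_over Q a \<longrightarrow> eval_term Q a s = eval_term Q a t)})"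

section \<open>Multiplication groups and inner mapping groups\<close>

text \<open>Mappings of \<open>Q\<close> are elements of the library's group \<open>BijGroup (carrier Q)\<close> of
  bijections of the carrier; its elements are extensional functions, hence the
  restricted abstractions.\<close>

definition L_map :: "('a, 'b) loop_scheme \<Rightarrow> 'a \<Rightarrow> 'a \<Rightarrow> 'a" where
  "L_map Q x = (\<lambda>y \<in> carrier Q. x \<otimes>\<^bsub>Q\<^esub> y)"

definition R_map :: "('a, 'b) loop_scheme \<Rightarrow> 'a \<Rightarrow> 'a \<Rightarrow> 'a" where
  "R_map Q x = (\<lambda>y \<in> carrier Q. y \<otimes>\<^bsub>Q\<^esub> x)"

definition M_map :: "('a, 'b) loop_scheme \<Rightarrow> 'a \<Rightarrow> 'a \<Rightarrow> 'a" where
  "M_map Q x = (\<lambda>y \<in> carrier Q. ldiv Q y x)"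

definition Mlt :: "('a, 'b) loop_scheme \<Rightarrow> ('a \<Rightarrow> 'a) set" where
  "Mlt Q = generate (BijGroup (carrier Q))
     (L_map Q ` carrier Q \<union> R_map Q ` carrier Q)"

definition TMlt :: "('a, 'b) loop_scheme \<Rightarrow> ('a \<Rightarrow> 'a) set" where
  "TMlt Q = generate (BijGroup (carrier Q))
     (L_map Q ` carrier Q \<union> R_map Q ` carrier Q \<union> M_map Q ` carrier Q)"

definition Inn :: "('a, 'b) loop_scheme \<Rightarrow> ('a \<Rightarrow> 'a) set" where
  "Inn Q = {f \<in> Mlt Q. f \<one>\<^bsub>Q\<^esub> = \<one>\<^bsub>Q\<^esub>}"

definition TInn :: "('a, 'b) loop_scheme \<Rightarrow> ('a \<Rightarrow> 'a) set" where
  "TInn Q = {f \<in> TMlt Q. f \<one>\<^bsub>Q\<^esub> = \<one>\<^bsub>Q\<^esub>}"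

section \<open>Words\<close>

datatype letter = L loop_term | R loop_term | M loop_term

text \<open>An element of the free group on the letters is given by a list representing it, where
  \<open>(True, k)\<close> stands for the letter \<open>k\<close> and \<open>(False, k)\<close> for its formal inverse. The mapping
  assigned to a word is its image in \<open>BijGroup (carrier Q)\<close>, so it does not depend on the
  choice of the representing list.\<close>

type_synonym word = "(bool \<times> letter) list"

primrec letter_map :: "('a, 'b) loop_scheme \<Rightarrow> (nat \<Rightarrow> 'a) \<Rightarrow> letter \<Rightarrow> 'a \<Rightarrow> 'a" where
  "letter_map Q a (L t) = L_map Q (eval_term Q a t)"
| "letter_map Q a (R t) = R_map Q (eval_term Q a t)"
| "letter_map Q a (M t) = M_map Q (eval_term Q a t)"

fun word_map :: "('a, 'b) loop_scheme \<Rightarrow> word \<Rightarrow> (nat \<Rightarrow> 'a) \<Rightarrow> 'a \<Rightarrow> 'a" where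
  "word_map Q [] a = \<one>\<^bsub>BijGroup (carrier Q)\<^esub>"
| "word_map Q ((True, k) # W) a =
     letter_map Q a k \<otimes>\<^bsub>BijGroup (carrier Q)\<^esub> word_map Q W a"
| "word_map Q ((False, k) # W) a =
     (inv\<^bsub>BijGroup (carrier Q)\<^esub> letter_map Q a k) \<otimes>\<^bsub>BijGroup (carrier Q)\<^esub> word_map Q W a"

definition inner_word :: "'a loop set \<Rightarrow> word \<Rightarrow> bool" where
  "inner_word V W \<longleftrightarrow> (\<forall>Q \<in> V. \<forall>a. tuple_over Q a \<longrightarrow> word_map Q W a \<in> TInn Q)"

definition generates_inner_mapping_groups :: "word set \<Rightarrow> 'a loop set \<Rightarrow> bool" where
  "generates_inner_mapping_groups \<W> V \<longleftrightarrow>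
     (\<forall>W \<in> \<W>. inner_word V W) \<and>
     (\<forall>Q \<in> V. Inn Q =
        generate (BijGroup (carrier Q)) {word_map Q W a |W a. W \<in> \<W> \<and> tuple_over Q a})"

section \<open>Congruences and the commutator\<close>

definition congruence :: "('a, 'b) loop_scheme \<Rightarrow> ('a \<times> 'a) set \<Rightarrow> bool" where
  "congruence Q \<theta> \<longleftrightarrow> equiv (carrier Q) \<theta> \<and>
     (\<forall>(x, x') \<in> \<theta>. \<forall>(y, y') \<in> \<theta>.
        (x \<otimes>\<^bsub>Q\<^esub> y, x' \<otimes>\<^bsub>Q\<^esub> y') \<in> \<theta> \<and>
        (ldiv Q x y, ldiv Q x' y') \<in> \<theta> \<and>
        (rdiv Q x y, rdiv Q x' y') \<in> \<theta>)"

definition Cg :: "('a, 'b) loop_scheme \<Rightarrow> ('a \<times> 'a) set \<Rightarrow> ('a \<times> 'a) set" where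
  "Cg Q S = congruence Q hull S"

definition tuple_rel :: "('a \<times> 'a) set \<Rightarrow> (nat \<Rightarrow> 'a) \<Rightarrow> (nat \<Rightarrow> 'a) \<Rightarrow> bool" where
  "tuple_rel \<beta> u v \<longleftrightarrow> (\<forall>i. (u i, v i) \<in> \<beta>)"

text \<open>The assignment \<open>case_nat a u\<close> sends variable \<open>0\<close> to \<open>a\<close> and variable \<open>i + 1\<close> to \<open>u i\<close>.\<close>

definition centralizes ::
  "('a, 'b) loop_scheme \<Rightarrow> ('a \<times> 'a) set \<Rightarrow> ('a \<times> 'a) set \<Rightarrow> ('a \<times> 'a) set \<Rightarrow> bool" where
  "centralizes Q \<alpha> \<beta> \<delta> \<longleftrightarrow>
     (\<forall>t a b u v. (a, b) \<in> \<alpha> \<longrightarrow> tuple_rel \<beta> u v \<longrightarrow>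
        (eval_term Q (case_nat a u) t, eval_term Q (case_nat a v) t) \<in> \<delta> \<longrightarrow>
        (eval_term Q (case_nat b u) t, eval_term Q (case_nat b v) t) \<in> \<delta>)"

definition commutator ::
  "('a, 'b) loop_scheme \<Rightarrow> ('a \<times> 'a) set \<Rightarrow> ('a \<times> 'a) set \<Rightarrow> ('a \<times> 'a) set" where
  "commutator Q \<alpha> \<beta> = (LEAST \<delta>. congruence Q \<delta> \<and> centralizes Q \<alpha> \<beta> \<delta>)"

text \<open>The least such congruence exists: the intersection of all of them is one of them.\<close>

lemma (in loop) eval_term_closed: "tuple_over Q a \<Longrightarrow> eval_term Q a t \<in> carrier Q"
  by (induction t)
    (auto simp: tuple_over_def one_closed mult_closed ldiv_closed rdiv_closed)

lemma (in loop) congruence_full: "congruence Q (carrier Q \<times> carrier Q)"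
  by (auto simp: congruence_def equiv_def refl_on_def sym_def trans_def
      mult_closed ldiv_closed rdiv_closed)

lemma congruence_Inter:
  assumes "D \<noteq> {}" and "\<And>\<delta>. \<delta> \<in> D \<Longrightarrow> congruence Q \<delta>"
  shows "congruence Q (\<Inter>D)"
proof -
  have eq: "equiv (carrier Q) \<delta>" if "\<delta> \<in> D" for \<delta>
    using assms(2)[OF that] by (simp add: congruence_def)
  have "equiv (carrier Q) (\<Inter>D)"
  proof (rule equivI)
    show "\<Inter>D \<subseteq> carrier Q \<times> carrier Q"
      using assms(1) eq by (auto simp: equiv_def)
    show "refl_on (carrier Q) (\<Inter>D)" using eq by (auto simp: equiv_def refl_on_def)
    show "sym (\<Inter>D)" using eq by (auto simp: equiv_def sym_def)
    show "trans (\<Inter>D)" using eq unfolding equiv_def trans_def by blast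
  qed
  then show ?thesis
    using assms(2) unfolding congruence_def by fast
qed

lemma (in loop) commutator_smallest:
  assumes "congruence Q \<alpha>" and "congruence Q \<beta>"
  shows "congruence Q (commutator Q \<alpha> \<beta>)"
    and "centralizes Q \<alpha> \<beta> (commutator Q \<alpha> \<beta>)"
    and "\<lbrakk>congruence Q \<delta>; centralizes Q \<alpha> \<beta> \<delta>\<rbrakk> \<Longrightarrow> commutator Q \<alpha> \<beta> \<subseteq> \<delta>"
proof -
  define D where "D = {\<delta>. congruence Q \<delta> \<and> centralizes Q \<alpha> \<beta> \<delta>}"
  have sub: "\<alpha> \<subseteq> carrier Q \<times> carrier Q" "\<beta> \<subseteq> carrier Q \<times> carrier Q"
    using assms by (auto simp: congruence_def equiv_def)
  have "centralizes Q \<alpha> \<beta> (carrier Q \<times> carrier Q)"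
    unfolding centralizes_def
  proof (intro allI impI SigmaI eval_term_closed)
    fix a b and u v :: "nat \<Rightarrow> 'a"
    assume *: "(a, b) \<in> \<alpha>" "tuple_rel \<beta> u v"
    have "b \<in> carrier Q" "\<And>i. u i \<in> carrier Q" "\<And>i. v i \<in> carrier Q"
      using * sub unfolding tuple_rel_def by blast+
    then show "tuple_over Q (case_nat b u)" "tuple_over Q (case_nat b v)"
      by (auto simp: tuple_over_def split: nat.split)
  qed
  then have "D \<noteq> {}" using congruence_full by (auto simp: D_def)
  then have "congruence Q (\<Inter>D)" by (rule congruence_Inter) (simp add: D_def)
  moreover have "centralizes Q \<alpha> \<beta> (\<Inter>D)"
    unfolding centralizes_def D_def by blast
  moreover have "commutator Q \<alpha> \<beta> = \<Inter>D"
    unfolding commutator_def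
    by (rule Least_equality) (use calculation in \<open>auto simp: D_def\<close>)
  ultimately show "congruence Q (commutator Q \<alpha> \<beta>)"
    and "centralizes Q \<alpha> \<beta> (commutator Q \<alpha> \<beta>)"
    and "\<lbrakk>congruence Q \<delta>; centralizes Q \<alpha> \<beta> \<delta>\<rbrakk> \<Longrightarrow> commutator Q \<alpha> \<beta> \<subseteq> \<delta>"
    by (auto simp: D_def)
qed

end

theory Submission
  imports Defs "HOL-Library.Countable"
begin

text \<open>Let \<open>\<delta>\<close> be the right-hand side. Words are terms and inner words fix \<open>1\<close>, so \<open>\<delta>\<close> lies in the
  commutator. Conversely, a word in the letters \<open>L\<close> and \<open>R\<close> that fixes \<open>1\<close> in every loop factors
  through \<open>\<W>\<close> in the relatively free loop of \<open>Q\<close>, hence uniformly in \<open>Q\<close>; so its values at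
  \<open>a \<in> [1]\<^sub>\<alpha>\<close> with \<open>\<beta>\<close>-related parameters are \<open>\<delta>\<close>-related. Three such words show that the
  matrices with rows \<open>(x, y)\<close> and \<open>(d x, e y)\<close>, where \<open>1 \<alpha> d \<delta> e\<close> and \<open>x \<beta> y\<close>, are closed under
  multiplication. Since \<open>L\<^sub>x\<^sup>n = R\<^sub>x\<^sup>n = 1\<close>, the divisions of \<open>Q\<close> are iterated multiplications, so
  these matrices contain all matrices of term values in the definition of \<open>C(\<alpha>, \<beta>; \<delta>)\<close>.\<close>

section \<open>Substitution, homomorphisms and congruences\<close>

primrec subst_term :: "(nat \<Rightarrow> loop_term) \<Rightarrow> loop_term \<Rightarrow> loop_term" where
  "subst_term \<sigma> (Var i) = \<sigma> i"
| "subst_term \<sigma> One = One"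
| "subst_term \<sigma> (Mult s t) = Mult (subst_term \<sigma> s) (subst_term \<sigma> t)"
| "subst_term \<sigma> (LDiv s t) = LDiv (subst_term \<sigma> s) (subst_term \<sigma> t)"
| "subst_term \<sigma> (RDiv s t) = RDiv (subst_term \<sigma> s) (subst_term \<sigma> t)"

lemma eval_subst_term: "eval_term Q a (subst_term \<sigma> t) = eval_term Q (\<lambda>i. eval_term Q a (\<sigma> i)) t"
  by (induction t) simp_all

definition loop_hom :: "('a, 'b) loop_scheme \<Rightarrow> ('c, 'd) loop_scheme \<Rightarrow> ('a \<Rightarrow> 'c) set" where
  "loop_hom F Q = {\<phi> \<in> carrier F \<rightarrow> carrier Q. \<phi> \<one>\<^bsub>F\<^esub> = \<one>\<^bsub>Q\<^esub> \<and>
     (\<forall>x \<in> carrier F. \<forall>y \<in> carrier F. \<phi> (x \<otimes>\<^bsub>F\<^esub> y) = \<phi> x \<otimes>\<^bsub>Q\<^esub> \<phi> y \<and>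
        \<phi> (ldiv F x y) = ldiv Q (\<phi> x) (\<phi> y) \<and> \<phi> (rdiv F x y) = rdiv Q (\<phi> x) (\<phi> y))}"

lemma loop_hom_eval_term:
  assumes "loop F" "\<phi> \<in> loop_hom F Q" "tuple_over F a"
  shows "\<phi> (eval_term F a t) = eval_term Q (\<lambda>i. \<phi> (a i)) t"
proof -
  have "eval_term F a t \<in> carrier F" for t by (rule loop.eval_term_closed[OF assms(1,3)])
  then show ?thesis using assms(2) by (induction t) (simp_all add: loop_hom_def)
qed

lemma congruence_mult:
  "\<lbrakk>congruence Q \<theta>; (x, x') \<in> \<theta>; (y, y') \<in> \<theta>\<rbrakk> \<Longrightarrow> (x \<otimes>\<^bsub>Q\<^esub> y, x' \<otimes>\<^bsub>Q\<^esub> y') \<in> \<theta>"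
  unfolding congruence_def by fast

lemma congruence_ldiv:
  "\<lbrakk>congruence Q \<theta>; (x, x') \<in> \<theta>; (y, y') \<in> \<theta>\<rbrakk> \<Longrightarrow> (ldiv Q x y, ldiv Q x' y') \<in> \<theta>"
  unfolding congruence_def by fast

lemma congruence_rdiv:
  "\<lbrakk>congruence Q \<theta>; (x, x') \<in> \<theta>; (y, y') \<in> \<theta>\<rbrakk> \<Longrightarrow> (rdiv Q x y, rdiv Q x' y') \<in> \<theta>"
  unfolding congruence_def by fast

lemma congruence_refl: "\<lbrakk>congruence Q \<theta>; x \<in> carrier Q\<rbrakk> \<Longrightarrow> (x, x) \<in> \<theta>"
  by (auto simp: congruence_def equiv_def refl_on_def)

lemma congruence_sym: "\<lbrakk>congruence Q \<theta>; (x, y) \<in> \<theta>\<rbrakk> \<Longrightarrow> (y, x) \<in> \<theta>"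
  by (auto simp: congruence_def equiv_def dest: symD)

lemma congruence_trans: "\<lbrakk>congruence Q \<theta>; (x, y) \<in> \<theta>; (y, z) \<in> \<theta>\<rbrakk> \<Longrightarrow> (x, z) \<in> \<theta>"
  by (auto simp: congruence_def equiv_def dest: transD)

lemma congruence_closed:
  assumes "congruence Q \<theta>" "(x, y) \<in> \<theta>"
  shows "x \<in> carrier Q" "y \<in> carrier Q"
  using assms by (auto simp: congruence_def equiv_def)

lemma (in loop) congruence_eval_term:
  assumes "congruence Q \<theta>" "tuple_rel \<theta> u v"
  shows "(eval_term Q u t, eval_term Q v t) \<in> \<theta>"
  using assms one_closed
  by (induction t)
    (auto simp: tuple_rel_def congruence_refl congruence_mult congruence_ldiv congruence_rdiv)

section \<open>Words as terms\<close>

text \<open>For the formal inverse of \<open>M\<close>: solving \<open>ldiv Q y t = s\<close> for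
  \<open>y\<close> gives \<open>rdiv Q t s\<close>.\<close>

primrec letter_term :: "bool \<Rightarrow> letter \<Rightarrow> loop_term \<Rightarrow> loop_term" where
  "letter_term b (L t) s = (if b then Mult t s else LDiv t s)"
| "letter_term b (R t) s = (if b then Mult s t else RDiv s t)"
| "letter_term b (M t) s = (if b then LDiv s t else RDiv t s)"

primrec subst_letter :: "(nat \<Rightarrow> loop_term) \<Rightarrow> letter \<Rightarrow> letter" where
  "subst_letter \<sigma> (L t) = L (subst_term \<sigma> t)"
| "subst_letter \<sigma> (R t) = R (subst_term \<sigma> t)"
| "subst_letter \<sigma> (M t) = M (subst_term \<sigma> t)"

text \<open>Variable \<open>0\<close> stands for the argument of the mapping, and variable \<open>i + 1\<close> for the
  variable \<open>i\<close> of the word.\<close>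

primrec word_term :: "word \<Rightarrow> loop_term" where
  "word_term [] = Var 0"
| "word_term (p # W) = letter_term (fst p) (subst_letter (\<lambda>i. Var (Suc i)) (snd p)) (word_term W)"

section \<open>Pointwise computation in the group of bijections\<close>

lemma BijGroup_inv_apply:
  assumes "f \<in> Bij S" "x \<in> S" "f x = y"
  shows "(inv\<^bsub>BijGroup S\<^esub> f) y = x"
proof -
  have "inj_on f S" "y \<in> S" using assms by (auto simp: Bij_def bij_betw_def)
  then show ?thesis using assms by (auto simp: inv_BijGroup inv_into_f_f)
qed

lemma BijGroup_mult_apply:
  "\<lbrakk>f \<in> Bij S; g \<in> Bij S; x \<in> S\<rbrakk> \<Longrightarrow> (f \<otimes>\<^bsub>BijGroup S\<^esub> g) x = f (g x)"
  by (simp add: BijGroup_def compose_eq)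

lemma carrier_BijGroup: "carrier (BijGroup S) = Bij S"
  by (simp add: BijGroup_def)

lemma BijGroup_one_apply: "x \<in> S \<Longrightarrow> \<one>\<^bsub>BijGroup S\<^esub> x = x"
  by (simp add: BijGroup_def)

lemma BijGroup_closed:
  "\<one>\<^bsub>BijGroup S\<^esub> \<in> Bij S"
  "f \<in> Bij S \<Longrightarrow> inv\<^bsub>BijGroup S\<^esub> f \<in> Bij S"
  "\<lbrakk>f \<in> Bij S; g \<in> Bij S\<rbrakk> \<Longrightarrow> f \<otimes>\<^bsub>BijGroup S\<^esub> g \<in> Bij S"
proof -
  interpret B: group "BijGroup S" by (rule group_BijGroup)
  show "\<one>\<^bsub>BijGroup S\<^esub> \<in> Bij S" "f \<in> Bij S \<Longrightarrow> inv\<^bsub>BijGroup S\<^esub> f \<in> Bij S"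
    "\<lbrakk>f \<in> Bij S; g \<in> Bij S\<rbrakk> \<Longrightarrow> f \<otimes>\<^bsub>BijGroup S\<^esub> g \<in> Bij S"
    using B.one_closed B.inv_closed B.m_closed by (simp_all add: carrier_BijGroup)
qed

lemma Bij_closed: "\<lbrakk>f \<in> Bij S; x \<in> S\<rbrakk> \<Longrightarrow> f x \<in> S"
  using Bij_imp_funcset by blast

lemma BijGroup_pow_apply:
  assumes "f \<in> Bij S" "y \<in> S"
  shows "(f [^]\<^bsub>BijGroup S\<^esub> (m :: nat)) y = (f ^^ m) y"
  using assms(2)
proof (induction m arbitrary: y)
  case 0
  then show ?case by (simp add: BijGroup_one_apply nat_pow_def)
next
  case (Suc m)
  interpret B: group "BijGroup S" by (rule group_BijGroup)
  have "f [^]\<^bsub>BijGroup S\<^esub> m \<in> Bij S"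
    using B.nat_pow_closed[of f m] assms by (simp add: carrier_BijGroup)
  then show ?case
    using Suc assms(1) by (simp add: BijGroup_mult_apply Bij_closed funpow_swap1)
qed

lemma maps_apply:
  assumes "y \<in> carrier Q"
  shows "L_map Q x y = x \<otimes>\<^bsub>Q\<^esub> y" "R_map Q x y = y \<otimes>\<^bsub>Q\<^esub> x" "M_map Q x y = ldiv Q y x"
  using assms by (simp_all add: L_map_def R_map_def M_map_def)

section \<open>Translations and word mappings of a loop\<close>

context loop
begin

lemma rdiv_ldiv: "\<lbrakk>x \<in> carrier Q; y \<in> carrier Q\<rbrakk> \<Longrightarrow> rdiv Q x (ldiv Q y x) = y"
  using mult_rdiv[of "ldiv Q y x" y] by (simp add: ldiv_closed mult_ldiv)

lemma ldiv_rdiv: "\<lbrakk>x \<in> carrier Q; y \<in> carrier Q\<rbrakk> \<Longrightarrow> ldiv Q (rdiv Q x y) x = y"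
  using ldiv_mult[of "rdiv Q x y" y] by (simp add: rdiv_closed rdiv_mult)

lemma rdiv_self: "x \<in> carrier Q \<Longrightarrow> rdiv Q x x = \<one>"
  using mult_rdiv[of x \<one>] by (simp add: one_closed mult_one_left)

lemma ldiv_self: "x \<in> carrier Q \<Longrightarrow> ldiv Q x x = \<one>"
  using ldiv_mult[of x \<one>] by (simp add: one_closed mult_one_right)

lemma L_map_Bij: "x \<in> carrier Q \<Longrightarrow> L_map Q x \<in> Bij (carrier Q)"
  unfolding Bij_def L_map_def
  by (auto simp: mult_closed ldiv_closed ldiv_mult mult_ldiv
      intro!: bij_betw_byWitness[where f' = "ldiv Q x"])

lemma R_map_Bij: "x \<in> carrier Q \<Longrightarrow> R_map Q x \<in> Bij (carrier Q)"
  unfolding Bij_def R_map_def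
  by (auto simp: mult_closed rdiv_closed rdiv_mult mult_rdiv
      intro!: bij_betw_byWitness[where f' = "\<lambda>y. rdiv Q y x"])

lemma M_map_Bij: "x \<in> carrier Q \<Longrightarrow> M_map Q x \<in> Bij (carrier Q)"
  unfolding Bij_def M_map_def
  by (auto simp: ldiv_closed rdiv_closed rdiv_ldiv ldiv_rdiv
      intro!: bij_betw_byWitness[where f' = "\<lambda>y. rdiv Q x y"])

lemma letter_map_Bij: "tuple_over Q a \<Longrightarrow> letter_map Q a k \<in> Bij (carrier Q)"
  by (cases k) (simp_all add: L_map_Bij R_map_Bij M_map_Bij eval_term_closed)

lemma word_map_Bij: "tuple_over Q a \<Longrightarrow> word_map Q W a \<in> Bij (carrier Q)"
proof (induction W)
  case (Cons p W)
  then show ?case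
    by (cases p; cases "fst p") (auto simp: letter_map_Bij BijGroup_closed)
qed (simp add: BijGroup_closed)

text \<open>Rewrites inverses in \<open>BijGroup\<close> as loop divisions, so that inductions over
  words meet only loop operations; the conditional covers both signs of a letter.\<close>

lemma letter_map_apply:
  assumes "tuple_over Q a" "z \<in> carrier Q"
  shows "(if b then letter_map Q a k else inv\<^bsub>BijGroup (carrier Q)\<^esub> letter_map Q a k) z =
    (case k of L t \<Rightarrow> (if b then eval_term Q a t \<otimes> z else ldiv Q (eval_term Q a t) z)
      | R t \<Rightarrow> (if b then z \<otimes> eval_term Q a t else rdiv Q z (eval_term Q a t))
      | M t \<Rightarrow> (if b then ldiv Q z (eval_term Q a t) else rdiv Q (eval_term Q a t) z))"
proof (cases b)
  case True
  then show ?thesis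
    using assms by (cases k) (simp_all add: maps_apply)
next
  case False
  have e: "eval_term Q a t \<in> carrier Q" for t by (rule eval_term_closed[OF assms(1)])
  have B: "letter_map Q a k \<in> Bij (carrier Q)" by (rule letter_map_Bij[OF assms(1)])
  show ?thesis
    using False assms(2) e B
    by (cases k) (auto intro!: BijGroup_inv_apply
        simp: maps_apply ldiv_closed rdiv_closed mult_ldiv rdiv_mult ldiv_rdiv)
qed

lemma word_map_Cons_apply:
  assumes "tuple_over Q a" "y \<in> carrier Q"
  shows "word_map Q ((b, k) # W) a y =
    (if b then letter_map Q a k else inv\<^bsub>BijGroup (carrier Q)\<^esub> letter_map Q a k) (word_map Q W a y)"
  using assms
  by (cases b) (simp_all add: BijGroup_mult_apply BijGroup_closed letter_map_Bij word_map_Bij)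

lemma word_map_closed: "\<lbrakk>tuple_over Q a; y \<in> carrier Q\<rbrakk> \<Longrightarrow> word_map Q W a y \<in> carrier Q"
  by (rule Bij_closed[OF word_map_Bij])

text \<open>Makes term arguments available for words: homomorphisms and congruences respect them,
  and the term condition of the commutator applies to them.\<close>

lemma word_map_eval_term:
  assumes "tuple_over Q a" "y \<in> carrier Q"
  shows "word_map Q W a y = eval_term Q (case_nat y a) (word_term W)"
proof (induction W)
  case Nil
  then show ?case using assms by (simp add: BijGroup_one_apply)
next
  case (Cons p W)
  obtain b k where p: "p = (b, k)" by (cases p)
  show ?case
    unfolding p word_map_Cons_apply[OF assms]
      letter_map_apply[OF assms(1) word_map_closed[OF assms]]
    unfolding Cons
    by (cases k) (simp_all add: eval_subst_term)
qed

lemma word_map_loop_hom: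
  assumes "loop P" "\<phi> \<in> loop_hom Q P" "tuple_over Q a" "y \<in> carrier Q"
  shows "\<phi> (word_map Q W a y) = word_map P W (\<lambda>i. \<phi> (a i)) (\<phi> y)"
proof -
  have "tuple_over Q (case_nat y a)"
    using assms by (auto simp: tuple_over_def split: nat.split)
  moreover have "tuple_over P (\<lambda>i. \<phi> (a i))" "\<phi> y \<in> carrier P"
    using assms by (auto simp: tuple_over_def loop_hom_def)
  moreover have "(\<lambda>i. \<phi> (case_nat y a i)) = case_nat (\<phi> y) (\<lambda>i. \<phi> (a i))"
    by (auto split: nat.split)
  ultimately show ?thesis
    using assms
    by (simp add: word_map_eval_term loop.word_map_eval_term loop_hom_eval_term[OF loop_axioms])
qed

lemma tuple_rel_over:
  assumes "congruence Q \<theta>" "tuple_rel \<theta> u v"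
  shows "tuple_over Q u" "tuple_over Q v"
  using assms congruence_closed[OF assms(1)] unfolding tuple_over_def tuple_rel_def by blast+

lemma word_map_cong:
  assumes "congruence Q \<theta>" "tuple_rel \<theta> u v" "(x, y) \<in> \<theta>"
  shows "(word_map Q W u x, word_map Q W v y) \<in> \<theta>"
proof -
  have "tuple_rel \<theta> (case_nat x u) (case_nat y v)"
    using assms by (auto simp: tuple_rel_def split: nat.split)
  then show ?thesis
    using assms congruence_closed[OF assms(1)] tuple_rel_over[OF assms(1,2)]
    by (simp add: word_map_eval_term congruence_eval_term)
qed

text \<open>Each signed letter is undone by a loop operation with the same parameter, and
  congruences respect all three operations; the induction strips the outermost letter.\<close>

lemma word_map_cancel:
  assumes "congruence Q \<theta>" "tuple_over Q u" "x \<in> carrier Q" "y \<in> carrier Q"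
    and "(word_map Q W u x, word_map Q W u y) \<in> \<theta>"
  shows "(x, y) \<in> \<theta>"
  using assms(5)
proof (induction W)
  case Nil
  then show ?case using assms by (simp add: BijGroup_one_apply)
next
  case (Cons p W)
  obtain b k where p: "p = (b, k)" by (cases p)
  define x' y' where "x' = word_map Q W u x" and "y' = word_map Q W u y"
  have c: "x' \<in> carrier Q" "y' \<in> carrier Q"
    unfolding x'_def y'_def using assms by (auto intro: word_map_closed)
  have e: "eval_term Q u t \<in> carrier Q" for t by (rule eval_term_closed[OF assms(2)])
  have r: "(eval_term Q u t, eval_term Q u t) \<in> \<theta>" for t
    by (rule congruence_refl[OF assms(1) e])
  have "((if b then letter_map Q u k else inv\<^bsub>BijGroup (carrier Q)\<^esub> letter_map Q u k) x',
      (if b then letter_map Q u k else inv\<^bsub>BijGroup (carrier Q)\<^esub> letter_map Q u k) y') \<in> \<theta>"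
    using Cons.prems
    unfolding p word_map_Cons_apply[OF assms(2,3)] word_map_Cons_apply[OF assms(2,4)] x'_def y'_def .
  then have *: "(case k of
        L t \<Rightarrow> (if b then eval_term Q u t \<otimes> x' else ldiv Q (eval_term Q u t) x')
      | R t \<Rightarrow> (if b then x' \<otimes> eval_term Q u t else rdiv Q x' (eval_term Q u t))
      | M t \<Rightarrow> (if b then ldiv Q x' (eval_term Q u t) else rdiv Q (eval_term Q u t) x'),
      case k of
        L t \<Rightarrow> (if b then eval_term Q u t \<otimes> y' else ldiv Q (eval_term Q u t) y')
      | R t \<Rightarrow> (if b then y' \<otimes> eval_term Q u t else rdiv Q y' (eval_term Q u t))
      | M t \<Rightarrow> (if b then ldiv Q y' (eval_term Q u t) else rdiv Q (eval_term Q u t) y')) \<in> \<theta>"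
    unfolding letter_map_apply[OF assms(2) c(1)] letter_map_apply[OF assms(2) c(2)] .
  have "(x', y') \<in> \<theta>"
  proof (cases k)
    case (L t)
    show ?thesis
      using L * congruence_mult[OF assms(1) r, of _ _ t] congruence_ldiv[OF assms(1) r, of _ _ t] c e
      by (cases b) (force simp: ldiv_mult mult_ldiv)+
  next
    case (R t)
    show ?thesis
      using R * congruence_mult[OF assms(1) _ r, of _ _ t] congruence_rdiv[OF assms(1) _ r, of _ _ t] c e
      by (cases b) (force simp: rdiv_mult mult_rdiv)+
  next
    case (M t)
    show ?thesis
      using M * congruence_rdiv[OF assms(1) r, of _ _ t] congruence_ldiv[OF assms(1) _ r, of _ _ t] c e
      by (cases b) (force simp: rdiv_ldiv ldiv_rdiv)+
  qed
  then show ?case unfolding x'_def y'_def by (rule Cons.IH)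
qed

end

section \<open>The relatively free loop\<close>

instance loop_term :: countable
  by countable_datatype

text \<open>The elements of the loop \<open>F\<close> are the classes of terms that agree on \<open>Q\<close>, encoded
  injectively in the type \<open>'a\<close>.\<close>

lemma relatively_free_loop:
  fixes Q :: "'a loop"
  assumes "infinite (UNIV :: 'a set)" "loop_variety V" "Q \<in> V"
  obtains F :: "'a loop" and c :: "loop_term \<Rightarrow> 'a"
  where "F \<in> V" "carrier F = range c"
    and "\<And>u. tuple_over Q u \<Longrightarrow> \<exists>\<phi> \<in> loop_hom F Q. \<forall>t. \<phi> (c t) = eval_term Q u t"
proof -
  obtain E where V: "V = {Q. loop Q \<and>
      (\<forall>(s, t) \<in> E. \<forall>a. tuple_over Q a \<longrightarrow> eval_term Q a s = eval_term Q a t)}"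
    using assms(2) unfolding loop_variety_def by blast
  then interpret loop Q using assms(3) by blast
  define eqv where "eqv s t \<longleftrightarrow> (\<forall>a. tuple_over Q a \<longrightarrow> eval_term Q a s = eval_term Q a t)" for s t
  \<comment> \<open>The choice depends only on the class of \<open>t\<close>: if
    \<open>eqv s t\<close>, then \<open>eqv s\<close> and \<open>eqv t\<close> are the same
    predicate, so \<open>SOME\<close> returns the same term.\<close>
  define r where "r t = (SOME s. eqv t s)" for t
  have r: "eqv t (r t)" for t unfolding r_def by (rule someI[of _ t]) (simp add: eqv_def)
  obtain g :: "nat \<Rightarrow> 'a" where g: "inj g"
    using infinite_countable_subset[OF assms(1)] by blast
  \<comment> \<open>Terms are countable and the type is infinite, so the representatives embed into
    \<open>'a\<close>.\<close>
  define c where "c t = g (to_nat (r t))" for t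
  have c: "c s = c t \<longleftrightarrow> eqv s t" for s t
  proof
    assume "c s = c t"
    then have "r s = r t" using g by (simp add: c_def inj_eq)
    then show "eqv s t" using r[of s] r[of t] by (simp add: eqv_def)
  next
    assume "eqv s t"
    then have "eqv s = eqv t" by (auto simp: eqv_def fun_eq_iff)
    then show "c s = c t" by (simp add: c_def r_def)
  qed
  define d where "d = inv_into UNIV c"
  have d: "eqv (d (c t)) t" for t
    unfolding c[symmetric] d_def by (simp add: f_inv_into_f)
  have d_eval: "tuple_over Q u \<Longrightarrow> eval_term Q u (d (c t)) = eval_term Q u t" for u t
    using d[of t] by (simp add: eqv_def)
  define F :: "'a loop" where "F = \<lparr>carrier = range c, monoid.mult = \<lambda>x y. c (Mult (d x) (d y)),
    one = c One, ldiv = \<lambda>x y. c (LDiv (d x) (d y)), rdiv = \<lambda>x y. c (RDiv (d x) (d y))\<rparr>"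
  have F_ops: "carrier F = range c" "\<one>\<^bsub>F\<^esub> = c One" "c s \<otimes>\<^bsub>F\<^esub> c t = c (Mult s t)"
    "ldiv F (c s) (c t) = c (LDiv s t)" "rdiv F (c s) (c t) = c (RDiv s t)" for s t
    by (auto simp: F_def c eqv_def d_eval)
  have "loop F"
    by unfold_locales
      (auto simp: F_ops c eqv_def eval_term_closed mult_one_right mult_one_left
        ldiv_mult mult_ldiv mult_rdiv rdiv_mult intro: rangeI)
  \<comment> \<open>Evaluation at classes is substitution into terms, so an identity of
    \<open>E\<close> in \<open>F\<close> reduces to its substitution instances in
    \<open>Q\<close>.\<close>
  moreover have eval_F: "eval_term F (\<lambda>i. c (\<sigma> i)) t = c (subst_term \<sigma> t)" for \<sigma> t
    by (induction t) (simp_all add: F_ops)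
  have "eval_term F a s = eval_term F a t" if "(s, t) \<in> E" "tuple_over F a" for s t a
  proof -
    have "\<forall>i. \<exists>t. a i = c t" using that(2) by (auto simp: tuple_over_def F_ops)
    then obtain \<sigma> where "a = (\<lambda>i. c (\<sigma> i))" by metis
    moreover have "eqv (subst_term \<sigma> s) (subst_term \<sigma> t)"
      using assms(3) that(1) unfolding eqv_def eval_subst_term V
      by (auto simp: tuple_over_def eval_term_closed)
    ultimately show ?thesis by (simp add: eval_F c)
  qed
  ultimately have "F \<in> V" unfolding V by blast
  \<comment> \<open>The classes of variables are free generators: the homomorphism evaluates a
    chosen representative, and \<open>d_eval\<close> makes the choice irrelevant.\<close>
  moreover have "\<exists>\<phi> \<in> loop_hom F Q. \<forall>t. \<phi> (c t) = eval_term Q u t" if "tuple_over Q u" for u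
    using that
    by (intro bexI[of _ "\<lambda>x. eval_term Q u (d x)"])
      (auto simp: loop_hom_def F_ops d_eval eval_term_closed)
  ultimately show thesis using that F_ops(1) by blast
qed

section \<open>Inner words and the commutator\<close>

text \<open>Words without \<open>M\<close> define elements of \<open>Mlt\<close>; since
  \<open>Inn\<close> is the stabilizer in \<open>Mlt\<close>, not in \<open>TMlt\<close>, these are
  the words to be factored through \<open>\<W>\<close>.\<close>

definition mult_word :: "word \<Rightarrow> bool" where
  "mult_word U \<longleftrightarrow> (\<forall>(b, k) \<in> set U. \<forall>t. k \<noteq> M t)"

context loop
begin

lemma mult_word_Mlt:
  assumes "tuple_over Q a" "mult_word U"
  shows "word_map Q U a \<in> Mlt Q"
  using assms(2)
proof (induction U)
  case Nil
  then show ?case by (simp add: Mlt_def generate.one)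
next
  case (Cons p U)
  obtain b k where p: "p = (b, k)" by (cases p)
  have U: "word_map Q U a \<in> Mlt Q" using Cons by (simp add: mult_word_def)
  have "letter_map Q a k \<in> L_map Q ` carrier Q \<union> R_map Q ` carrier Q"
    using Cons.prems p eval_term_closed[OF assms(1)] by (cases k) (auto simp: mult_word_def)
  then show ?case
    using U unfolding p Mlt_def by (cases b) (auto intro: generate.eng generate.incl generate.inv)
qed

end

lemma inner_word_one:
  assumes "inner_word V W" "Q \<in> V" "tuple_over Q a"
  shows "word_map Q W a \<one>\<^bsub>Q\<^esub> = \<one>\<^bsub>Q\<^esub>"
  using assms by (auto simp: inner_word_def TInn_def)

text \<open>Here \<delta> stands for the generated congruence: it contains the generating pairs and
  lies below \<beta>, so that \<delta>-related elements can serve as word parameters.\<close>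

locale inner_congruence = loop Q for Q :: "'a loop" (structure) +
  fixes V :: "'a loop set" and \<W> :: "word set" and \<alpha> \<beta> \<delta> :: "('a \<times> 'a) set"
  assumes infinite_UNIV: "infinite (UNIV :: 'a set)"
    and variety: "loop_variety V"
    and generates: "generates_inner_mapping_groups \<W> V"
    and Q_in_V: "Q \<in> V"
    and cong: "congruence Q \<alpha>" "congruence Q \<beta>" "congruence Q \<delta>"
    and \<delta>_subset: "\<delta> \<subseteq> \<beta>"
    and \<W>_\<delta>: "\<lbrakk>W \<in> \<W>; (\<one>, a) \<in> \<alpha>; tuple_rel \<beta> u v\<rbrakk> \<Longrightarrow> (word_map Q W u a, word_map Q W v a) \<in> \<delta>"
begin

text \<open>An inner word fixes \<open>\<one>\<close>, and a congruence is both preserved by a word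
  and reflected by it, so the word permutes the \<alpha>-class of \<open>\<one>\<close>.\<close>

lemma \<W>_\<alpha>:
  assumes "W \<in> \<W>" "tuple_over Q u" "x \<in> carrier Q"
  shows "(\<one>, word_map Q W u x) \<in> \<alpha> \<longleftrightarrow> (\<one>, x) \<in> \<alpha>"
proof -
  have one: "word_map Q W u \<one> = \<one>"
    using generates assms Q_in_V
    by (auto simp: generates_inner_mapping_groups_def intro: inner_word_one)
  have rel: "tuple_rel \<alpha> u u"
    using assms(2) cong(1) by (simp add: tuple_rel_def tuple_over_def congruence_refl)
  show ?thesis
    using word_map_cong[OF cong(1) rel, of \<one> x W] one_closed
      word_map_cancel[OF cong(1) assms(2) one_closed assms(3), of W]
    unfolding one by blast
qed

text \<open>The homomorphisms \<open>\<phi>\<close> and \<open>\<psi>\<close> turn a single factorization in \<open>Inn F\<close> into two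
  factorizations in \<open>Inn Q\<close> with the same words and \<open>\<beta>\<close>-related parameters.\<close>

lemma Inn_hom:
  assumes "F \<in> V" "\<phi> \<in> loop_hom F Q" "\<psi> \<in> loop_hom F Q"
    and "\<And>x. x \<in> carrier F \<Longrightarrow> (\<phi> x, \<psi> x) \<in> \<beta>"
    and "f \<in> Inn F" "x \<in> carrier F" "(\<one>, \<phi> x) \<in> \<alpha>" "(\<phi> x, \<psi> x) \<in> \<delta>"
  shows "(\<one>, \<phi> (f x)) \<in> \<alpha> \<and> (\<phi> (f x), \<psi> (f x)) \<in> \<delta>"
proof -
  interpret F: loop F using variety assms(1) by (auto simp: loop_variety_def)
  let ?G = "{word_map F W a |W a. W \<in> \<W> \<and> tuple_over F a}"
  have params: "tuple_over Q (\<lambda>i. \<phi> (a i))" "tuple_over Q (\<lambda>i. \<psi> (a i))"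
    "tuple_rel \<beta> (\<lambda>i. \<phi> (a i)) (\<lambda>i. \<psi> (a i))" if "tuple_over F a" for a
    using assms that by (auto simp: loop_hom_def tuple_over_def tuple_rel_def)
  have \<phi>: "\<phi> x \<in> carrier Q" and \<psi>: "\<psi> x \<in> carrier Q" if "x \<in> carrier F" for x
    using assms(2,3) that by (auto simp: loop_hom_def)
  have refl: "tuple_rel \<delta> u u" if "tuple_over Q u" for u
    using that cong by (simp add: tuple_rel_def tuple_over_def congruence_refl)
  note \<phi>_word = F.word_map_loop_hom[OF loop_axioms assms(2)]
    and \<psi>_word = F.word_map_loop_hom[OF loop_axioms assms(3)]
  have "f \<in> generate (BijGroup (carrier F)) ?G"
    using assms(1,5) generates unfolding generates_inner_mapping_groups_def by blast
  \<comment> \<open>The claim is quantified over \<open>x\<close> because products and inverses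
    change the argument, and it carries the \<alpha>-class because \<open>\<W>_\<delta>\<close>
    requires it.\<close>
  then have "f \<in> Bij (carrier F) \<and> (\<forall>x \<in> carrier F. (\<one>, \<phi> x) \<in> \<alpha> \<longrightarrow> (\<phi> x, \<psi> x) \<in> \<delta> \<longrightarrow>
      (\<one>, \<phi> (f x)) \<in> \<alpha> \<and> (\<phi> (f x), \<psi> (f x)) \<in> \<delta>)"
  proof induction
    case one
    show ?case by (simp add: BijGroup_closed BijGroup_one_apply)
  next
    case (incl f)
    then obtain W a where W: "W \<in> \<W>" and a: "tuple_over F a" and f: "f = word_map F W a"
      by blast
    show ?case
    proof (intro conjI ballI impI)
      show "f \<in> Bij (carrier F)" unfolding f by (rule F.word_map_Bij[OF a])
      fix x assume x: "x \<in> carrier F" "(\<one>, \<phi> x) \<in> \<alpha>" "(\<phi> x, \<psi> x) \<in> \<delta>"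
      show "(\<one>, \<phi> (f x)) \<in> \<alpha>"
        unfolding f \<phi>_word[OF a x(1)] \<W>_\<alpha>[OF W params(1)[OF a] \<phi>[OF x(1)]] by (rule x(2))
      \<comment> \<open>First the parameters change at the common argument \<open>\<phi> x\<close>,
        then the argument changes at the fixed parameters \<open>\<psi> (a i)\<close>.\<close>
      show "(\<phi> (f x), \<psi> (f x)) \<in> \<delta>"
        unfolding f \<phi>_word[OF a x(1)] \<psi>_word[OF a x(1)]
        by (rule congruence_trans[OF cong(3) \<W>_\<delta>[OF W x(2) params(3)[OF a]]
              word_map_cong[OF cong(3) refl[OF params(2)[OF a]] x(3)]])
    qed
  next
    case (inv f)
    then obtain W a where W: "W \<in> \<W>" and a: "tuple_over F a" and f: "f = word_map F W a"
      by blast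
    have B: "f \<in> Bij (carrier F)" unfolding f by (rule F.word_map_Bij[OF a])
    show ?case
    proof (intro conjI ballI impI)
      show "inv\<^bsub>BijGroup (carrier F)\<^esub> f \<in> Bij (carrier F)" by (rule BijGroup_closed(2)[OF B])
      fix x assume x: "x \<in> carrier F" "(\<one>, \<phi> x) \<in> \<alpha>" "(\<phi> x, \<psi> x) \<in> \<delta>"
      obtain z where z: "z \<in> carrier F" "f z = x"
      proof -
        have "f ` carrier F = carrier F" using B by (simp add: Bij_def bij_betw_def)
        then have "x \<in> f ` carrier F" using x(1) by simp
        then show thesis using that by auto
      qed
      have inv: "(inv\<^bsub>BijGroup (carrier F)\<^esub> f) x = z"
        by (rule BijGroup_inv_apply[OF B z])
      have \<phi>x: "\<phi> x = word_map Q W (\<lambda>i. \<phi> (a i)) (\<phi> z)"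
        and \<psi>x: "\<psi> x = word_map Q W (\<lambda>i. \<psi> (a i)) (\<psi> z)"
        unfolding z(2)[symmetric] f by (rule \<phi>_word[OF a z(1)] \<psi>_word[OF a z(1)])+
      show \<alpha>: "(\<one>, \<phi> ((inv\<^bsub>BijGroup (carrier F)\<^esub> f) x)) \<in> \<alpha>"
        using x(2) unfolding inv \<phi>x \<W>_\<alpha>[OF W params(1)[OF a] \<phi>[OF z(1)]] .
      \<comment> \<open>With \<open>\<phi> z\<close> known to lie in the \<alpha>-class of
        \<open>\<one>\<close>, \<open>\<W>_\<delta>\<close> exchanges the parameters at
        \<open>\<phi> z\<close>; the word with common parameters is then cancelled.\<close>
      have "(word_map Q W (\<lambda>i. \<psi> (a i)) (\<phi> z), word_map Q W (\<lambda>i. \<psi> (a i)) (\<psi> z)) \<in> \<delta>"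
        using congruence_trans[OF cong(3)
            congruence_sym[OF cong(3) \<W>_\<delta>[OF W \<alpha>[unfolded inv] params(3)[OF a]]]]
          x(3) unfolding \<phi>x \<psi>x by blast
      then show "(\<phi> ((inv\<^bsub>BijGroup (carrier F)\<^esub> f) x), \<psi> ((inv\<^bsub>BijGroup (carrier F)\<^esub> f) x)) \<in> \<delta>"
        unfolding inv by (rule word_map_cancel[OF cong(3) params(2)[OF a] \<phi>[OF z(1)] \<psi>[OF z(1)]])
    qed
  next
    case (eng f g)
    then show ?case by (simp add: BijGroup_closed BijGroup_mult_apply Bij_closed)
  qed
  then show ?thesis using assms by blast
qed

text \<open>Free of \<open>M\<close> and fixing the unit, \<open>U\<close> with generic parameters
  lies in \<open>Inn F\<close> and factors through \<open>\<W>\<close>; \<open>Inn_hom\<close>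
  transfers the factorization. Finally \<open>d\<close> becomes \<open>e\<close> at constant
  parameters.\<close>

lemma mult_word_\<delta>:
  assumes "mult_word U" and inner: "\<And>(P :: 'a loop) a. \<lbrakk>loop P; tuple_over P a\<rbrakk> \<Longrightarrow> word_map P U a \<one>\<^bsub>P\<^esub> = \<one>\<^bsub>P\<^esub>"
    and "tuple_rel \<beta> u v" "(\<one>, d) \<in> \<alpha>" "(d, e) \<in> \<delta>"
  shows "(\<one>, word_map Q U u d) \<in> \<alpha>" "(word_map Q U u d, word_map Q U v e) \<in> \<delta>"
proof -
  obtain F :: "'a loop" and c where F: "F \<in> V" "carrier F = range c"
    and hom: "\<And>u. tuple_over Q u \<Longrightarrow> \<exists>\<phi> \<in> loop_hom F Q. \<forall>t. \<phi> (c t) = eval_term Q u t"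
    by (rule relatively_free_loop[OF infinite_UNIV variety Q_in_V]) (rule that)
  interpret F: loop F using variety F(1) by (auto simp: loop_variety_def)
  have d: "d \<in> carrier Q" by (rule congruence_closed[OF cong(1) assms(4)])
  \<comment> \<open>Variable \<open>0\<close> has the value \<open>d\<close> in both tuples, so
    \<open>\<phi>\<close> and \<open>\<psi>\<close> agree on the argument \<open>x\<close>, and
    \<open>Inn_hom\<close> starts from a trivial \<delta>-pair.\<close>
  have rel: "tuple_rel \<beta> (case_nat d u) (case_nat d v)"
    using assms(3) cong d by (auto simp: tuple_rel_def congruence_refl split: nat.split)
  note over = tuple_rel_over[OF cong(2) rel]
  obtain \<phi> where \<phi>: "\<phi> \<in> loop_hom F Q" "\<And>t. \<phi> (c t) = eval_term Q (case_nat d u) t"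
    using hom[OF over(1)] by blast
  obtain \<psi> where \<psi>: "\<psi> \<in> loop_hom F Q" "\<And>t. \<psi> (c t) = eval_term Q (case_nat d v) t"
    using hom[OF over(2)] by blast
  define a where "a i = c (Var (Suc i))" for i
  have a: "tuple_over F a" by (simp add: tuple_over_def a_def F)
  define x where "x = c (Var 0)"
  have x: "x \<in> carrier F" by (simp add: x_def F)
  have \<phi>\<psi>: "(\<lambda>i. \<phi> (a i)) = u" "\<phi> x = d" "(\<lambda>i. \<psi> (a i)) = v" "\<psi> x = d"
    by (simp_all add: a_def x_def \<phi> \<psi>)
  have f: "word_map F U a \<in> Inn F"
    using F.mult_word_Mlt[OF a assms(1)] inner[OF F.loop_axioms a] by (simp add: Inn_def)
  have "(\<phi> y, \<psi> y) \<in> \<beta>" if "y \<in> carrier F" for y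
    using that congruence_eval_term[OF cong(2) rel] by (auto simp: F \<phi> \<psi>)
  from Inn_hom[OF F(1) \<phi>(1) \<psi>(1) this f x]
  have *: "(\<one>, word_map Q U u d) \<in> \<alpha>" "(word_map Q U u d, word_map Q U v d) \<in> \<delta>"
    unfolding F.word_map_loop_hom[OF loop_axioms \<phi>(1) a x]
      F.word_map_loop_hom[OF loop_axioms \<psi>(1) a x] \<phi>\<psi>
    using assms(4) cong d by (auto simp: congruence_refl)
  show "(\<one>, word_map Q U u d) \<in> \<alpha>" by (rule *)
  have "tuple_rel \<delta> v v"
    using tuple_rel_over[OF cong(2) assms(3)] cong
    by (simp add: tuple_rel_def tuple_over_def congruence_refl)
  from word_map_cong[OF cong(3) this assms(5)]
  show "(word_map Q U u d, word_map Q U v e) \<in> \<delta>"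
    by (rule congruence_trans[OF cong(3) *(2)])
qed

text \<open>The values k, g, p of the three words at \<open>d\<close> are the solutions of (d x) y =
  k (x y), x (d y) = g (x y) and x (d y) = (x p) y, which collect factors on the left. For d = 1
  each solution is 1, so the words fix the unit.\<close>

lemma inner_words_\<delta>:
  assumes "(x, x') \<in> \<beta>" "(y, y') \<in> \<beta>" "(\<one>, d) \<in> \<alpha>" "(d, e) \<in> \<delta>"
  shows "(\<one>, rdiv Q ((d \<otimes> x) \<otimes> y) (x \<otimes> y)) \<in> \<alpha>"
    and "(rdiv Q ((d \<otimes> x) \<otimes> y) (x \<otimes> y), rdiv Q ((e \<otimes> x') \<otimes> y') (x' \<otimes> y')) \<in> \<delta>"
    and "(\<one>, rdiv Q (x \<otimes> (d \<otimes> y)) (x \<otimes> y)) \<in> \<alpha>"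
    and "(rdiv Q (x \<otimes> (d \<otimes> y)) (x \<otimes> y), rdiv Q (x' \<otimes> (e \<otimes> y')) (x' \<otimes> y')) \<in> \<delta>"
    and "(\<one>, ldiv Q x (rdiv Q (x \<otimes> (d \<otimes> y)) y)) \<in> \<alpha>"
    and "(ldiv Q x (rdiv Q (x \<otimes> (d \<otimes> y)) y), ldiv Q x' (rdiv Q (x' \<otimes> (e \<otimes> y')) y')) \<in> \<delta>"
proof -
  \<comment> \<open>Only variables \<open>0\<close> and \<open>1\<close> occur in the words; the
    tuples are constant from index \<open>1\<close> on.\<close>
  let ?u = "case_nat x (\<lambda>_. y)" and ?v = "case_nat x' (\<lambda>_. y')"
  let ?R = "[(False, R (Mult (Var 0) (Var 1))), (True, R (Var 1)), (True, R (Var 0))]"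
  let ?L = "[(False, R (Mult (Var 0) (Var 1))), (True, L (Var 0)), (True, R (Var 1))]"
  let ?C = "[(False, L (Var 0)), (False, R (Var 1)), (True, L (Var 0)), (True, R (Var 1))]"
  have rel: "tuple_rel \<beta> ?u ?v"
    using assms by (auto simp: tuple_rel_def split: nat.split)
  note over = tuple_rel_over[OF cong(2) rel]
  have d: "d \<in> carrier Q" by (rule congruence_closed[OF cong(1) assms(3)])
  have e: "e \<in> carrier Q" by (rule congruence_closed[OF cong(3) assms(4)])
  have mult: "mult_word ?R" "mult_word ?L" "mult_word ?C" by (simp_all add: mult_word_def)
  have inner: "word_map P ?R a \<one>\<^bsub>P\<^esub> = \<one>\<^bsub>P\<^esub>" "word_map P ?L a \<one>\<^bsub>P\<^esub> = \<one>\<^bsub>P\<^esub>"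
    "word_map P ?C a \<one>\<^bsub>P\<^esub> = \<one>\<^bsub>P\<^esub>" if "loop P" "tuple_over P a" for P :: "'a loop" and a
  proof -
    interpret P: loop P by (rule that(1))
    have "a i \<in> carrier P" for i using that(2) by (simp add: tuple_over_def)
    then show "word_map P ?R a \<one>\<^bsub>P\<^esub> = \<one>\<^bsub>P\<^esub>" "word_map P ?L a \<one>\<^bsub>P\<^esub> = \<one>\<^bsub>P\<^esub>"
      "word_map P ?C a \<one>\<^bsub>P\<^esub> = \<one>\<^bsub>P\<^esub>"
      unfolding P.word_map_eval_term[OF that(2) P.one_closed]
      by (simp_all add: P.mult_one_left P.mult_closed P.rdiv_self P.ldiv_self P.mult_rdiv)
  qed
  note eval = word_map_eval_term[OF over(1) d] word_map_eval_term[OF over(2) e]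
  show "(\<one>, rdiv Q ((d \<otimes> x) \<otimes> y) (x \<otimes> y)) \<in> \<alpha>"
    "(rdiv Q ((d \<otimes> x) \<otimes> y) (x \<otimes> y), rdiv Q ((e \<otimes> x') \<otimes> y') (x' \<otimes> y')) \<in> \<delta>"
    using mult_word_\<delta>[OF mult(1) inner(1) rel assms(3,4)] unfolding eval by simp_all
  show "(\<one>, rdiv Q (x \<otimes> (d \<otimes> y)) (x \<otimes> y)) \<in> \<alpha>"
    "(rdiv Q (x \<otimes> (d \<otimes> y)) (x \<otimes> y), rdiv Q (x' \<otimes> (e \<otimes> y')) (x' \<otimes> y')) \<in> \<delta>"
    using mult_word_\<delta>[OF mult(2) inner(2) rel assms(3,4)] unfolding eval by simp_all
  show "(\<one>, ldiv Q x (rdiv Q (x \<otimes> (d \<otimes> y)) y)) \<in> \<alpha>"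
    "(ldiv Q x (rdiv Q (x \<otimes> (d \<otimes> y)) y), ldiv Q x' (rdiv Q (x' \<otimes> (e \<otimes> y')) y')) \<in> \<delta>"
    using mult_word_\<delta>[OF mult(3) inner(3) rel assms(3,4)] unfolding eval by simp_all
qed

text \<open>A rectangle with rows \<open>(x, y)\<close> and \<open>(z, w)\<close>: the quotients \<open>z / x \<in> [1]\<^sub>\<alpha>\<close> and
  \<open>w / y\<close> of its columns agree modulo \<open>\<delta>\<close>.\<close>

definition parallel :: "'a \<Rightarrow> 'a \<Rightarrow> 'a \<Rightarrow> 'a \<Rightarrow> bool" where
  "parallel x y z w \<longleftrightarrow> (\<exists>d e. (\<one>, d) \<in> \<alpha> \<and> (d, e) \<in> \<delta> \<and> (x, y) \<in> \<beta> \<and> z = d \<otimes> x \<and> w = e \<otimes> y)"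

lemma parallel_closed:
  assumes "parallel x y z w"
  shows "x \<in> carrier Q" "y \<in> carrier Q" "z \<in> carrier Q" "w \<in> carrier Q"
proof -
  obtain d e where *: "(\<one>, d) \<in> \<alpha>" "(d, e) \<in> \<delta>" "(x, y) \<in> \<beta>" "z = d \<otimes> x" "w = e \<otimes> y"
    using assms unfolding parallel_def by blast
  show "x \<in> carrier Q" "y \<in> carrier Q" "z \<in> carrier Q" "w \<in> carrier Q"
    using congruence_closed[OF cong(3) *(2)] congruence_closed[OF cong(2) *(3)]
    by (simp_all add: *(4,5) mult_closed)
qed

text \<open>With z = d x and z' = d' x': z z' = g (z x') = g (k (x x')) = (g p) (x x'), each
  correction coming from one of the inner words. The second column is rewritten alike with h, l,
  q.\<close>

lemma parallel_mult:
  assumes "parallel x y z w" "parallel x' y' z' w'"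
  shows "parallel (x \<otimes> x') (y \<otimes> y') (z \<otimes> z') (w \<otimes> w')"
proof -
  obtain d e where de: "(\<one>, d) \<in> \<alpha>" "(d, e) \<in> \<delta>" "(x, y) \<in> \<beta>" and z: "z = d \<otimes> x" and w: "w = e \<otimes> y"
    using assms(1) unfolding parallel_def by blast
  obtain d' e' where de': "(\<one>, d') \<in> \<alpha>" "(d', e') \<in> \<delta>" "(x', y') \<in> \<beta>"
    and z': "z' = d' \<otimes> x'" and w': "w' = e' \<otimes> y'"
    using assms(2) unfolding parallel_def by blast
  note closed = parallel_closed[OF assms(1)] parallel_closed[OF assms(2)]
  define k l where "k = rdiv Q ((d \<otimes> x) \<otimes> x') (x \<otimes> x')" and "l = rdiv Q ((e \<otimes> y) \<otimes> y') (y \<otimes> y')"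
  have kl: "(\<one>, k) \<in> \<alpha>" "(k, l) \<in> \<delta>"
    unfolding k_def l_def by (rule inner_words_\<delta>[OF de(3) de'(3) de(1,2)])+
  \<comment> \<open>The next word takes \<open>z\<close> and \<open>w\<close> as parameters, so they
    must be \<beta>-related; this uses \<delta> \<subseteq> \<beta>.\<close>
  have zw: "(z, w) \<in> \<beta>"
    unfolding z w using congruence_mult[OF cong(2)] de \<delta>_subset by blast
  define g h where "g = rdiv Q (z \<otimes> (d' \<otimes> x')) (z \<otimes> x')" and "h = rdiv Q (w \<otimes> (e' \<otimes> y')) (w \<otimes> y')"
  have gh: "(\<one>, g) \<in> \<alpha>" "(g, h) \<in> \<delta>"
    unfolding g_def h_def by (rule inner_words_\<delta>[OF zw de'(3) de'(1,2)])+
  have xx: "(x \<otimes> x', y \<otimes> y') \<in> \<beta>" by (rule congruence_mult[OF cong(2) de(3) de'(3)])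
  \<comment> \<open>The corrections \<open>g\<close>, \<open>h\<close> now become parameters, and
    \<open>k\<close>, \<open>l\<close> the arguments, of the third word.\<close>
  define p q where "p = ldiv Q g (rdiv Q (g \<otimes> (k \<otimes> (x \<otimes> x'))) (x \<otimes> x'))"
    and "q = ldiv Q h (rdiv Q (h \<otimes> (l \<otimes> (y \<otimes> y'))) (y \<otimes> y'))"
  have "(g, h) \<in> \<beta>" using gh \<delta>_subset by blast
  from inner_words_\<delta>(5,6)[OF this xx kl] have pq: "(\<one>, p) \<in> \<alpha>" "(p, q) \<in> \<delta>"
    unfolding p_def q_def by blast+
  have c: "g \<in> carrier Q" "h \<in> carrier Q" "k \<in> carrier Q" "l \<in> carrier Q"
    using gh kl congruence_closed[OF cong(3)] by blast+
  have "z \<otimes> z' = g \<otimes> (z \<otimes> x')" "z \<otimes> x' = k \<otimes> (x \<otimes> x')"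
    using closed by (simp_all add: g_def k_def z' z[symmetric] rdiv_mult mult_closed)
  then have "z \<otimes> z' = (g \<otimes> p) \<otimes> (x \<otimes> x')"
    using closed c by (simp add: p_def mult_closed rdiv_closed mult_ldiv rdiv_mult)
  moreover have "w \<otimes> w' = h \<otimes> (w \<otimes> y')" "w \<otimes> y' = l \<otimes> (y \<otimes> y')"
    using closed by (simp_all add: h_def l_def w' w[symmetric] rdiv_mult mult_closed)
  then have "w \<otimes> w' = (h \<otimes> q) \<otimes> (y \<otimes> y')"
    using closed c by (simp add: q_def mult_closed rdiv_closed mult_ldiv rdiv_mult)
  moreover have "(\<one>, g \<otimes> p) \<in> \<alpha>"
    using congruence_mult[OF cong(1) gh(1) pq(1)] by (simp add: mult_one_left one_closed)
  moreover have "(g \<otimes> p, h \<otimes> q) \<in> \<delta>"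
    by (rule congruence_mult[OF cong(3) gh(2) pq(2)])
  ultimately show ?thesis using xx unfolding parallel_def by blast
qed

lemma parallel_funpow_L:
  assumes "parallel x y z w" "parallel x' y' z' w'"
  shows "parallel (((\<otimes>) x ^^ m) x') (((\<otimes>) y ^^ m) y') (((\<otimes>) z ^^ m) z') (((\<otimes>) w ^^ m) w')"
  by (induction m) (simp_all add: assms parallel_mult)

lemma parallel_funpow_R:
  assumes "parallel x y z w" "parallel x' y' z' w'"
  shows "parallel (((\<lambda>s. s \<otimes> x) ^^ m) x') (((\<lambda>s. s \<otimes> y) ^^ m) y')
    (((\<lambda>s. s \<otimes> z) ^^ m) z') (((\<lambda>s. s \<otimes> w) ^^ m) w')"
  by (induction m) (simp_all add: assms parallel_mult)

text \<open>Both quotients are \<open>\<one>\<close>; this gives the rectangles of the variables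
  with values \<open>u i\<close>, \<open>v i\<close> and of the constant.\<close>

lemma parallel_refl:
  assumes "(x, y) \<in> \<beta>"
  shows "parallel x y x y"
proof -
  have "x \<in> carrier Q" "y \<in> carrier Q" using congruence_closed[OF cong(2) assms] .
  then show ?thesis
    unfolding parallel_def using assms cong one_closed
    by (intro exI[of _ \<one>]) (simp add: congruence_refl mult_one_left)
qed

text \<open>The common quotient is \<open>rdiv Q b a\<close>, which is \<alpha>-related to
  \<open>rdiv Q a a\<close>, that is, to \<open>\<one>\<close>; this is the rectangle of variable
  \<open>0\<close>.\<close>

lemma parallel_swap:
  assumes "(a, b) \<in> \<alpha>"
  shows "parallel a a b b"
proof -
  have ab: "a \<in> carrier Q" "b \<in> carrier Q" using congruence_closed[OF cong(1) assms] .
  have "(rdiv Q a a, rdiv Q b a) \<in> \<alpha>"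
    by (rule congruence_rdiv[OF cong(1) assms congruence_refl[OF cong(1) ab(1)]])
  then show ?thesis
    unfolding parallel_def using ab cong
    by (intro exI[of _ "rdiv Q b a"]) (simp add: congruence_refl rdiv_self rdiv_mult rdiv_closed)
qed

text \<open>Induction on terms: variables and the unit give rectangles, products preserve them, and
  divisions are \<open>m\<close>-fold multiplications with \<open>m\<close> independent of the
  elements.\<close>

lemma centralizes_\<delta>:
  assumes "\<And>x y. \<lbrakk>x \<in> carrier Q; y \<in> carrier Q\<rbrakk> \<Longrightarrow> ldiv Q x y = ((\<otimes>) x ^^ m) y"
    and "\<And>x y. \<lbrakk>x \<in> carrier Q; y \<in> carrier Q\<rbrakk> \<Longrightarrow> rdiv Q y x = ((\<lambda>z. z \<otimes> x) ^^ m) y"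
  shows "centralizes Q \<alpha> \<beta> \<delta>"
  unfolding centralizes_def
proof (intro allI impI)
  fix t a b and u v :: "nat \<Rightarrow> 'a"
  assume ab: "(a, b) \<in> \<alpha>" and uv: "tuple_rel \<beta> u v"
    and t: "(eval_term Q (case_nat a u) t, eval_term Q (case_nat a v) t) \<in> \<delta>"
  have "parallel (eval_term Q (case_nat a u) t) (eval_term Q (case_nat a v) t)
      (eval_term Q (case_nat b u) t) (eval_term Q (case_nat b v) t)"
  proof (induction t)
    case (Var i)
    then show ?case
      using uv ab by (cases i) (simp_all add: parallel_swap parallel_refl tuple_rel_def)
  next
    case One
    then show ?case using cong one_closed by (simp add: parallel_refl congruence_refl)
  next
    case (Mult s t)
    then show ?case by (simp add: parallel_mult)
  next
    case (LDiv s t)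
    show ?case
      using parallel_funpow_L[OF LDiv.IH, of m] parallel_closed[OF LDiv.IH(1)]
        parallel_closed[OF LDiv.IH(2)]
      by (simp add: assms(1))
  next
    case (RDiv s t)
    \<comment> \<open>In \<open>RDiv s t\<close> the second term is the multiplier and the first the
      starting value, hence the exchanged induction hypotheses.\<close>
    show ?case
      using parallel_funpow_R[OF RDiv.IH(2,1), of m] parallel_closed[OF RDiv.IH(1)]
        parallel_closed[OF RDiv.IH(2)]
      by (simp add: assms(2))
  qed
  \<comment> \<open>The second row is the first multiplied on the left by \<delta>-related
    quotients.\<close>
  then show "(eval_term Q (case_nat b u) t, eval_term Q (case_nat b v) t) \<in> \<delta>"
    using congruence_mult[OF cong(3)] t unfolding parallel_def by fastforce
qed

end

section \<open>Divisions as iterated multiplications; generated congruences\<close>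

context loop
begin

text \<open>If L_x^(m+1) = 1, then x times L_x^m(y) is y, so L_x^m(y) is the left quotient of y by
  x; likewise for R_x.\<close>

lemma division_funpow:
  assumes "x \<in> carrier Q" "y \<in> carrier Q"
  shows "L_map Q x [^]\<^bsub>BijGroup (carrier Q)\<^esub> Suc m = \<one>\<^bsub>BijGroup (carrier Q)\<^esub> \<Longrightarrow>
      ldiv Q x y = ((\<otimes>) x ^^ m) y"
    and "R_map Q x [^]\<^bsub>BijGroup (carrier Q)\<^esub> Suc m = \<one>\<^bsub>BijGroup (carrier Q)\<^esub> \<Longrightarrow>
      rdiv Q y x = ((\<lambda>z. z \<otimes> x) ^^ m) y"
proof -
  have closed: "((\<otimes>) x ^^ k) y \<in> carrier Q" "((\<lambda>z. z \<otimes> x) ^^ k) y \<in> carrier Q" for k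
    by (induction k) (simp_all add: assms mult_closed)
  have maps: "(L_map Q x ^^ k) y = ((\<otimes>) x ^^ k) y" "(R_map Q x ^^ k) y = ((\<lambda>z. z \<otimes> x) ^^ k) y" for k
    by (induction k) (simp_all add: maps_apply closed)
  show "ldiv Q x y = ((\<otimes>) x ^^ m) y"
    if "L_map Q x [^]\<^bsub>BijGroup (carrier Q)\<^esub> Suc m = \<one>\<^bsub>BijGroup (carrier Q)\<^esub>"
  proof -
    have "((\<otimes>) x ^^ Suc m) y = y"
      using BijGroup_pow_apply[OF L_map_Bij[OF assms(1)] assms(2), of "Suc m"] assms(2)
      unfolding that maps by (simp add: BijGroup_one_apply)
    then show ?thesis using ldiv_mult[OF assms(1) closed(1), of m] by simp
  qed
  show "rdiv Q y x = ((\<lambda>z. z \<otimes> x) ^^ m) y"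
    if "R_map Q x [^]\<^bsub>BijGroup (carrier Q)\<^esub> Suc m = \<one>\<^bsub>BijGroup (carrier Q)\<^esub>"
  proof -
    have "((\<lambda>z. z \<otimes> x) ^^ Suc m) y = y"
      using BijGroup_pow_apply[OF R_map_Bij[OF assms(1)] assms(2), of "Suc m"] assms(2)
      unfolding that maps by (simp add: BijGroup_one_apply)
    then show ?thesis using mult_rdiv[OF assms(1) closed(2), of m] by simp
  qed
qed

lemma congruence_Cg:
  assumes "S \<subseteq> carrier Q \<times> carrier Q"
  shows "congruence Q (Cg Q S)"
  unfolding Cg_def hull_def
  by (rule congruence_Inter) (use assms congruence_full in auto)

end

theorem theorem4p4:
  fixes V :: "'a loop set" and \<W> :: "word set" and Q :: "'a loop" and n :: nat
    and \<alpha> \<beta> :: "('a \<times> 'a) set"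
  assumes "infinite (UNIV :: 'a set)"
    and "loop_variety V"
    and "generates_inner_mapping_groups \<W> V"
    and "Q \<in> V"
    and "n > 0"
    and "\<forall>x \<in> carrier Q.
      L_map Q x [^]\<^bsub>BijGroup (carrier Q)\<^esub> n = \<one>\<^bsub>BijGroup (carrier Q)\<^esub> \<and>
      R_map Q x [^]\<^bsub>BijGroup (carrier Q)\<^esub> n = \<one>\<^bsub>BijGroup (carrier Q)\<^esub>"
    and "congruence Q \<alpha>"
    and "congruence Q \<beta>"
  shows "commutator Q \<alpha> \<beta> =
    Cg Q {(word_map Q W u a, word_map Q W v a) |W u v a.
            W \<in> \<W> \<and> (\<one>\<^bsub>Q\<^esub>, a) \<in> \<alpha> \<and> tuple_rel \<beta> u v}"
proof -
  interpret loop Q using assms(2,4) by (auto simp: loop_variety_def)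
  let ?S = "{(word_map Q W u a, word_map Q W v a) |W u v a.
            W \<in> \<W> \<and> (\<one>\<^bsub>Q\<^esub>, a) \<in> \<alpha> \<and> tuple_rel \<beta> u v}"
  note carrier = congruence_closed[OF assms(7)] and over = tuple_rel_over[OF assms(8)]
  \<comment> \<open>The parameters are \<beta>-related and the argument is shared. This also bounds
    the generated congruence by \<beta>.\<close>
  have S_\<beta>: "?S \<subseteq> \<beta>"
    using word_map_cong[OF assms(8)] congruence_refl[OF assms(8)] carrier by blast
  have "?S \<subseteq> carrier Q \<times> carrier Q"
    using S_\<beta> congruence_closed[OF assms(8)] by blast
  then have Cg: "congruence Q (Cg Q ?S)" by (rule congruence_Cg)
  have S_Cg: "?S \<subseteq> Cg Q ?S" unfolding Cg_def by (rule hull_subset)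
  \<comment> \<open>Division by \<open>x\<close> is the power \<open>n - 1\<close> of the
    translation; \<open>m\<close> is that exponent.\<close>
  obtain m where n: "n = Suc m" using assms(5) by (cases n) auto
  interpret inner_congruence Q V \<W> \<alpha> \<beta> "Cg Q ?S"
  proof unfold_locales
    show "Cg Q ?S \<subseteq> \<beta>" unfolding Cg_def using S_\<beta> assms(8) by (rule hull_minimal)
  qed (use assms Cg S_Cg in blast)+
  have "centralizes Q \<alpha> \<beta> (Cg Q ?S)"
    by (rule centralizes_\<delta>[of m]) (use assms(6) n division_funpow in blast)+
  then have "commutator Q \<alpha> \<beta> \<subseteq> Cg Q ?S"
    by (rule commutator_smallest(3)[OF assms(7,8) Cg])
  moreover have "Cg Q ?S \<subseteq> commutator Q \<alpha> \<beta>"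
    unfolding Cg_def
  proof (rule hull_minimal)
    show comm: "congruence Q (commutator Q \<alpha> \<beta>)" by (rule commutator_smallest(1)[OF assms(7,8)])
    show "?S \<subseteq> commutator Q \<alpha> \<beta>"
    proof clarify
      fix W u v a assume W: "W \<in> \<W>" and a: "(\<one>\<^bsub>Q\<^esub>, a) \<in> \<alpha>" and uv: "tuple_rel \<beta> u v"
      \<comment> \<open>The term condition is applied to \<open>word_term W\<close> with variable
        \<open>0\<close> changed from \<open>\<one>\<close> to \<open>a\<close>; its premise is the
        pair of units.\<close>
      have "word_map Q W u \<one>\<^bsub>Q\<^esub> = \<one>\<^bsub>Q\<^esub>" "word_map Q W v \<one>\<^bsub>Q\<^esub> = \<one>\<^bsub>Q\<^esub>"
        using assms(3,4) W over[OF uv]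
        by (auto simp: generates_inner_mapping_groups_def intro: inner_word_one)
      then have "(word_map Q W u \<one>\<^bsub>Q\<^esub>, word_map Q W v \<one>\<^bsub>Q\<^esub>) \<in> commutator Q \<alpha> \<beta>"
        by (simp add: congruence_refl[OF comm one_closed])
      then show "(word_map Q W u a, word_map Q W v a) \<in> commutator Q \<alpha> \<beta>"
        using commutator_smallest(2)[OF assms(7,8)] a uv
        unfolding centralizes_def word_map_eval_term[OF over(1)[OF uv] one_closed]
          word_map_eval_term[OF over(2)[OF uv] one_closed]
          word_map_eval_term[OF over(1)[OF uv] carrier(2)[OF a]]
          word_map_eval_term[OF over(2)[OF uv] carrier(2)[OF a]]
        by blast
    qed
  qed
  ultimately show ?thesis by blast
qed

end
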